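(* Let $\Omega$ be an open set in $\mathbb{R}^2$ and $a\in\Omega$. If $u:\Omega\to\mathbb{R}$ has a strong specular tangent hyperplane to the graph of $u$ at $(a,u[a])$, then the specularly normal vector of $u$ at $a$ is $$\left(\partial^S_{x_1}u(a),\ \partial^S_{x_2}u(a),\ -1\right).$$
   Context: Let $\Omega\subset\mathbb{R}^2$ be open, $u:\Omega\to\mathbb{R}$, $a=(a_1,a_2)\in\Omega$, $e_i$ the $i$-th standard basis vector. One-sided limits: $u[a)_{(i)}=\lim_{h\searrow0}u(a+he_i)$, $u(a]_{(i)}=\lim_{h\nearrow0}u(a+he_i)$, and $u[a]_{(i)}=\frac12(u[a)_{(i)}+u(a]_{(i)})$; if $u[a]_{(1)}=u[a]_{(2)}$ the common value is $u[a]$. One-sided specular partial derivatives: $\partial^R_{x_i}u(a)=\lim_{h\searrow0}\frac{u(a+he_i)-u[a)_{(i)}}{h}$ and $\partial^L_{x_i}u(a)=\lim_{h\nearrow0}\frac{u(a+he_i)-u(a]_{(i)}}{h}$, as real numbers. Specular partial differentiability at $a$ with respect to $x_i$ means that both exist and that $u[a)_{(i)}=u(a]_{(i)}$. With $\alpha_i=\partial^R_{x_i}u(a)$ and $\beta_i=\partial^L_{x_i}u(a)$, the specular partial derivative is $$\partial^S_{x_i}u(a)=\begin{cases}\dfrac{\alpha_i\beta_i-1+\sqrt{(\alpha_i^2+1)(\beta_i^2+1)}}{\alpha_i+\beta_i}&\alpha_i+\beta_i\ne0,\\0&\alpha_i+\beta_i=0.\end{cases}$$ Phototangent with respect to $x_i$: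 the graph over the line $a+\mathbb{R}e_i$ of the function equal, at $a+he_i$, to $\beta_ih+u(a]_{(i)}$ if $h<0$, $u[a]_{(i)}$ if $h=0$, and $\alpha_ih+u[a)_{(i)}$ if $h>0$; it is continuous when $u[a)_{(i)}=u(a]_{(i)}$. $\mathcal{P}(u,a)$ is the set of all intersection points in $\mathbb{R}^3$ of the phototangents of $u$ at $a$ (for those $i=1,2$ with respect to which $u$ is specularly partial differentiable) with the unit sphere centred at $(a,u[a]_{(i)})$. $u$ is weakly specularly differentiable at $a$ if $|\mathcal{P}(u,a)|\ge3$ and the values $u[a]_{(i)}$ agree for these $i$; $u$ is (strongly) specularly differentiable at $a$ if $|\mathcal{P}(u,a)|=4$ and $u[a]_{(1)}=u[a]_{(2)}$. A weak specular tangent hyperplane to the graph of $u$ at $(a,u[a])$ is a plane in $\mathbb{R}^3$ containing at least three points of $\mathcal{P}(u,a)$. A strong specular tangent hyperplane at $(a,u[a])$ is a plane containing all four points of $\mathcal{P}(u,a)$, where $u$ is specularly differentiable at $a$. A vector $v\in\mathbb{R}^3$ is a (specularly) normal vector to the surface of $u$ at $a$ if there is a weak specular tangent hyperplane to the graph of $u$ at $(a,u[a])$ which is perpendicular to $v$ (such vectors are considered up to a nonzero scalar multiple). *)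

theory Defs
  imports "HOL-Analysis.Analysis"
begin

text \<open>
  A function on an open set \<open>\<Omega>\<close> is represented by a total function on \<open>real ^ 2\<close>. The notions
  below at a point \<open>a \<in> \<Omega>\<close> depend only on the values of \<open>u\<close> near \<open>a\<close> (excluding \<open>a\<close> itself),
  so the values outside \<open>\<Omega>\<close> are irrelevant.
\<close>

text \<open>\<open>Lim\<close> and the one-sided derivatives are meaningful only if the limits exist; this is demanded
  in \<open>spec_partial_differentiable\<close>.\<close>

definition right_lim :: "(real ^ 2 \<Rightarrow> real) \<Rightarrow> real ^ 2 \<Rightarrow> 2 \<Rightarrow> real" where
  "right_lim u a i = Lim (at_right 0) (\<lambda>h. u (a + h *\<^sub>R axis i 1))"

definition left_lim :: "(real ^ 2 \<Rightarrow> real) \<Rightarrow> real ^ 2 \<Rightarrow> 2 \<Rightarrow> real" where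
  "left_lim u a i = Lim (at_left 0) (\<lambda>h. u (a + h *\<^sub>R axis i 1))"

definition mid_lim :: "(real ^ 2 \<Rightarrow> real) \<Rightarrow> real ^ 2 \<Rightarrow> 2 \<Rightarrow> real" where
  "mid_lim u a i = (right_lim u a i + left_lim u a i) / 2"

definition right_quot :: "(real ^ 2 \<Rightarrow> real) \<Rightarrow> real ^ 2 \<Rightarrow> 2 \<Rightarrow> real \<Rightarrow> real" where
  "right_quot u a i h = (u (a + h *\<^sub>R axis i 1) - right_lim u a i) / h"

definition left_quot :: "(real ^ 2 \<Rightarrow> real) \<Rightarrow> real ^ 2 \<Rightarrow> 2 \<Rightarrow> real \<Rightarrow> real" where
  "left_quot u a i h = (u (a + h *\<^sub>R axis i 1) - left_lim u a i) / h"

definition right_spec_partial :: "(real ^ 2 \<Rightarrow> real) \<Rightarrow> real ^ 2 \<Rightarrow> 2 \<Rightarrow> real" where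
  "right_spec_partial u a i = Lim (at_right 0) (right_quot u a i)"

definition left_spec_partial :: "(real ^ 2 \<Rightarrow> real) \<Rightarrow> real ^ 2 \<Rightarrow> 2 \<Rightarrow> real" where
  "left_spec_partial u a i = Lim (at_left 0) (left_quot u a i)"

definition spec_partial_differentiable :: "(real ^ 2 \<Rightarrow> real) \<Rightarrow> real ^ 2 \<Rightarrow> 2 \<Rightarrow> bool" where
  "spec_partial_differentiable u a i \<longleftrightarrow>
     (\<exists>l. ((\<lambda>h. u (a + h *\<^sub>R axis i 1)) \<longlongrightarrow> l) (at_right 0)) \<and>
     (\<exists>l. ((\<lambda>h. u (a + h *\<^sub>R axis i 1)) \<longlongrightarrow> l) (at_left 0)) \<and>
     (\<exists>\<alpha>. (right_quot u a i \<longlongrightarrow> \<alpha>) (at_right 0)) \<and>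
     (\<exists>\<beta>. (left_quot u a i \<longlongrightarrow> \<beta>) (at_left 0)) \<and>
     right_lim u a i = left_lim u a i"

definition spec_partial :: "(real ^ 2 \<Rightarrow> real) \<Rightarrow> real ^ 2 \<Rightarrow> 2 \<Rightarrow> real" where
  "spec_partial u a i =
     (let \<alpha> = right_spec_partial u a i; \<beta> = left_spec_partial u a i in
      if \<alpha> + \<beta> \<noteq> 0
      then (\<alpha> * \<beta> - 1 + sqrt ((\<alpha>\<^sup>2 + 1) * (\<beta>\<^sup>2 + 1))) / (\<alpha> + \<beta>)
      else 0)"

definition graph_point :: "real ^ 2 \<Rightarrow> real \<Rightarrow> real ^ 3" where
  "graph_point x t = vector [x $ 1, x $ 2, t]"

definition phototangent_fun :: "(real ^ 2 \<Rightarrow> real) \<Rightarrow> real ^ 2 \<Rightarrow> 2 \<Rightarrow> real \<Rightarrow> real" where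
  "phototangent_fun u a i h =
     (if h < 0 then left_spec_partial u a i * h + left_lim u a i
      else if h = 0 then mid_lim u a i
      else right_spec_partial u a i * h + right_lim u a i)"

definition phototangent :: "(real ^ 2 \<Rightarrow> real) \<Rightarrow> real ^ 2 \<Rightarrow> 2 \<Rightarrow> (real ^ 3) set" where
  "phototangent u a i =
     range (\<lambda>h. graph_point (a + h *\<^sub>R axis i 1) (phototangent_fun u a i h))"

text \<open>Each phototangent contributes at most two points, so this set is finite and \<open>card\<close>
  is its true cardinality.\<close>

definition photo_points :: "(real ^ 2 \<Rightarrow> real) \<Rightarrow> real ^ 2 \<Rightarrow> (real ^ 3) set" where
  "photo_points u a =
     (\<Union>i\<in>{i. spec_partial_differentiable u a i}.
        phototangent u a i \<inter> sphere (graph_point a (mid_lim u a i)) 1)"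

definition weakly_spec_differentiable :: "(real ^ 2 \<Rightarrow> real) \<Rightarrow> real ^ 2 \<Rightarrow> bool" where
  "weakly_spec_differentiable u a \<longleftrightarrow>
     card (photo_points u a) \<ge> 3 \<and>
     (\<forall>i j. spec_partial_differentiable u a i \<longrightarrow> spec_partial_differentiable u a j \<longrightarrow>
        mid_lim u a i = mid_lim u a j)"

definition spec_differentiable :: "(real ^ 2 \<Rightarrow> real) \<Rightarrow> real ^ 2 \<Rightarrow> bool" where
  "spec_differentiable u a \<longleftrightarrow>
     card (photo_points u a) = 4 \<and> mid_lim u a 1 = mid_lim u a 2"

definition is_plane :: "(real ^ 3) set \<Rightarrow> bool" where
  "is_plane H \<longleftrightarrow> affine H \<and> aff_dim H = 2"

text \<open>Weak specular differentiability is what gives the base point \<open>(a, u[a])\<close> a meaning: three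
  points can only arise from both phototangents, whose centres must then agree.\<close>

definition weak_spec_tangent_hyperplane ::
    "(real ^ 2 \<Rightarrow> real) \<Rightarrow> real ^ 2 \<Rightarrow> (real ^ 3) set \<Rightarrow> bool" where
  "weak_spec_tangent_hyperplane u a H \<longleftrightarrow>
     weakly_spec_differentiable u a \<and> is_plane H \<and> card (H \<inter> photo_points u a) \<ge> 3"

definition strong_spec_tangent_hyperplane ::
    "(real ^ 2 \<Rightarrow> real) \<Rightarrow> real ^ 2 \<Rightarrow> (real ^ 3) set \<Rightarrow> bool" where
  "strong_spec_tangent_hyperplane u a H \<longleftrightarrow>
     spec_differentiable u a \<and> is_plane H \<and> photo_points u a \<subseteq> H"

definition perpendicular_to_plane :: "real ^ 3 \<Rightarrow> (real ^ 3) set \<Rightarrow> bool" where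
  "perpendicular_to_plane v H \<longleftrightarrow> v \<noteq> 0 \<and> (\<forall>x\<in>H. \<forall>y\<in>H. orthogonal v (y - x))"

definition spec_normal_vector :: "(real ^ 2 \<Rightarrow> real) \<Rightarrow> real ^ 2 \<Rightarrow> real ^ 3 \<Rightarrow> bool" where
  "spec_normal_vector u a v \<longleftrightarrow>
     (\<exists>H. weak_spec_tangent_hyperplane u a H \<and> perpendicular_to_plane v H)"

end

theory Submission
  imports Defs
begin

text \<open>
  A vector \<open>n\<close> is orthogonal to the chord joining the two points cut out of the \<open>i\<close>-th
  phototangent precisely when its slope \<open>-n\<^sub>i / n\<^sub>3\<close> is
  \<open>(\<alpha> sqrt (\<beta>\<^sup>2 + 1) + \<beta> sqrt (\<alpha>\<^sup>2 + 1)) / (sqrt (\<alpha>\<^sup>2 + 1) + sqrt (\<beta>\<^sup>2 + 1))\<close>, which is another form of the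
  \<open>i\<close>-th specular partial derivative. Hence the two chords determine the normal of a strong tangent
  hyperplane. All four points lie on one sphere, so no three of them are collinear and every weak
  tangent hyperplane coincides with the strong one.
\<close>

text \<open>Among three collinear points one lies between the other two. If it differed from both,
  it would be strictly closer to the centre than one of them, by strict convexity of the
  ball.\<close>

lemma sphere_collinear_3:
  fixes z :: "'a::euclidean_space"
  assumes "x \<in> sphere z r" "y \<in> sphere z r" "w \<in> sphere z r" "collinear {x, y, w}"
  shows "x = y \<or> x = w \<or> y = w"
proof -
  have *: "p = q \<or> p = t"
    if "between (q, t) p" "p \<in> sphere z r" "q \<in> sphere z r" "t \<in> sphere z r" for p q t
  proof (rule ccontr)
    assume "\<not> (p = q \<or> p = t)"
    then have "p \<in> open_segment q t"
      using that(1) by (auto simp: open_segment_def between_mem_segment)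
    then show False
      using dist_decreases_open_segment[of p q t z] that(2-4) by auto
  qed
  from assms(4) show ?thesis
    unfolding collinear_between_cases using * assms(1-3) by metis
qed

text \<open>Three distinct points on a sphere are affinely independent, so their affine hull is
  already 2-dimensional and equals every plane through them.\<close>

lemma plane_eq_if_three_sphere_points:
  fixes z :: "real ^ 3"
  assumes "is_plane H" "is_plane K" "S \<subseteq> H" "S \<subseteq> K" "S \<subseteq> sphere z r" "card S \<ge> 3"
  shows "H = K"
proof -
  obtain T where "T \<subseteq> S" "card T = 3"
    using obtain_subset_with_card_n[OF assms(6)] by metis
  then obtain x y w where T: "{x, y, w} \<subseteq> S" "x \<noteq> y" "x \<noteq> w" "y \<noteq> w"
    unfolding card_3_iff by blast
  with assms(5) have "\<not> collinear {x, y, w}"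
    using sphere_collinear_3[of x z r y w] by blast
  then have "\<not> affine_dependent {x, y, w}"
    using collinear_3_eq_affine_dependent by blast
  then have "aff_dim {x, y, w} = int (card {x, y, w}) - 1"
    by (simp only: affine_independent_iff_card)
  then have dim: "aff_dim (affine hull {x, y, w}) = 2"
    using T by simp
  have "affine hull {x, y, w} = P" if "is_plane P" "S \<subseteq> P" for P
  proof (rule affine_dim_equal)
    show "affine hull {x, y, w} \<subseteq> P"
      using that T by (intro hull_minimal) (auto simp: is_plane_def)
  qed (use that dim in \<open>auto simp: is_plane_def\<close>)
  then show ?thesis using assms by metis
qed

lemma plane_normal_exists:
  assumes "is_plane H"
  shows "\<exists>v. perpendicular_to_plane v H"
proof -
  have "aff_dim H = DIM(real ^ 3) - 1" and hull: "affine hull H = H"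
    using assms by (auto simp: is_plane_def affine_hull_eq)
  then obtain n b where "n \<noteq> 0" "H = {x. n \<bullet> x = b}"
    unfolding aff_dim_eq_hyperplane hull by blast
  then have "perpendicular_to_plane n H"
    by (auto simp: perpendicular_to_plane_def orthogonal_def inner_diff_right)
  then show ?thesis ..
qed

lemma perpendicular_to_plane_scale:
  "perpendicular_to_plane v H \<Longrightarrow> c \<noteq> 0 \<Longrightarrow> perpendicular_to_plane (c *\<^sub>R v) H"
  by (auto simp: perpendicular_to_plane_def orthogonal_def)

text \<open>The conditional index carries the direction \<open>i\<close> of type \<open>2\<close>
  over to a coordinate of \<open>real ^ 3\<close>.\<close>

lemma inner_graph_point_diff:
  fixes v :: "real ^ 3"
  shows "v \<bullet> (graph_point (a + h *\<^sub>R axis i 1) s - graph_point (a + k *\<^sub>R axis i 1) t) =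
    (h - k) * v $ (if i = 1 then 1 else 2) + (s - t) * v $ 3"
  using exhaust_2[of i]
  by (auto simp: graph_point_def inner_vec_def sum_3 axis_def algebra_simps)

lemma graph_point_in_unit_sphere_iff:
  "graph_point (a + h *\<^sub>R axis i 1) s \<in> sphere (graph_point a t) 1 \<longleftrightarrow> h\<^sup>2 + (s - t)\<^sup>2 = 1"
proof -
  have "(dist (graph_point a t) (graph_point (a + h *\<^sub>R axis i 1) s))\<^sup>2 = h\<^sup>2 + (s - t)\<^sup>2"
    using exhaust_2[of i]
    unfolding dist_norm power2_norm_eq_inner
    by (auto simp: graph_point_def inner_vec_def sum_3 axis_def power2_eq_square algebra_simps)
  then show ?thesis
    unfolding mem_sphere by (smt (verit) power2_eq_1_iff zero_le_dist)
qed

lemma ray_meets_unit_circle_iff: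
  fixes c h :: real
  assumes "h \<ge> 0"
  shows "h\<^sup>2 + (c * h)\<^sup>2 = 1 \<longleftrightarrow> h = 1 / sqrt (c\<^sup>2 + 1)"
proof -
  have pos: "sqrt (c\<^sup>2 + 1) > 0"
    by (simp add: add_nonneg_pos)
  have "h\<^sup>2 + (c * h)\<^sup>2 = (h * sqrt (c\<^sup>2 + 1))\<^sup>2"
    by (simp add: algebra_simps)
  moreover have "h * sqrt (c\<^sup>2 + 1) \<ge> 0"
    using assms by simp
  ultimately have "h\<^sup>2 + (c * h)\<^sup>2 = 1 \<longleftrightarrow> h * sqrt (c\<^sup>2 + 1) = 1"
    using power2_eq_1_iff[of "h * sqrt (c\<^sup>2 + 1)"] by linarith
  also have "\<dots> \<longleftrightarrow> h = 1 / sqrt (c\<^sup>2 + 1)"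
    using pos by (intro nonzero_eq_divide_eq[symmetric]) simp
  finally show ?thesis .
qed

text \<open>Once the one-sided limits agree, the phototangent consists of two rays issuing from the
  centre of the sphere, and each ray meets the sphere exactly once.\<close>

lemma phototangent_Int_sphere:
  assumes "spec_partial_differentiable u a i"
  defines "m \<equiv> mid_lim u a i" and "\<alpha> \<equiv> right_spec_partial u a i" and "\<beta> \<equiv> left_spec_partial u a i"
  defines "A \<equiv> sqrt (\<alpha>\<^sup>2 + 1)" and "B \<equiv> sqrt (\<beta>\<^sup>2 + 1)"
  shows "phototangent u a i \<inter> sphere (graph_point a m) 1 =
    {graph_point (a + (1 / A) *\<^sub>R axis i 1) (m + \<alpha> * (1 / A)),
     graph_point (a + (- 1 / B) *\<^sub>R axis i 1) (m + \<beta> * (- 1 / B))}"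
proof -
  let ?f = "phototangent_fun u a i"
  \<comment> \<open>Both one-sided limits equal their mean \<open>m\<close>, so the case
    \<open>h = 0\<close> merges with the right branch.\<close>
  have f: "?f h = (if h < 0 then m + \<beta> * h else m + \<alpha> * h)" for h
    using assms(1) unfolding spec_partial_differentiable_def
    by (auto simp: phototangent_fun_def m_def mid_lim_def \<alpha>_def \<beta>_def)
  have pos: "A > 0" "B > 0"
    by (simp_all add: A_def B_def add_nonneg_pos)
  have meet: "h\<^sup>2 + (?f h - m)\<^sup>2 = 1 \<longleftrightarrow> h = 1 / A \<or> h = - 1 / B" for h
  proof (cases "h < 0")
    case True
    moreover have "1 / A > 0" using pos by simp
    ultimately have "h \<noteq> 1 / A" by linarith
    moreover have "h\<^sup>2 + (\<beta> * h)\<^sup>2 = 1 \<longleftrightarrow> - h = 1 / B"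
      using True ray_meets_unit_circle_iff[of "- h" \<beta>] by (simp add: B_def)
    ultimately show ?thesis using True by (auto simp: f)
  next
    case False
    moreover have "- 1 / B < 0" using pos by simp
    ultimately have "h \<noteq> - 1 / B" by linarith
    moreover have "h\<^sup>2 + (\<alpha> * h)\<^sup>2 = 1 \<longleftrightarrow> h = 1 / A"
      using False ray_meets_unit_circle_iff[of h \<alpha>] by (simp add: A_def)
    ultimately show ?thesis using False by (auto simp: f)
  qed
  have "phototangent u a i \<inter> sphere (graph_point a m) 1 =
      (\<lambda>h. graph_point (a + h *\<^sub>R axis i 1) (?f h)) ` {h. h\<^sup>2 + (?f h - m)\<^sup>2 = 1}"
    unfolding phototangent_def using graph_point_in_unit_sphere_iff by blast
  also have "{h. h\<^sup>2 + (?f h - m)\<^sup>2 = 1} = {1 / A, - 1 / B}"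
    using meet by auto
  finally show ?thesis using pos by (simp add: f)
qed

text \<open>This form has a positive denominator, so it needs no case distinction: if \<alpha> +
  \<beta> = 0, then \<open>A = B\<close> and the numerator vanishes. Otherwise the two fractions
  agree by cross-multiplication.\<close>

lemma spec_partial_alt:
  fixes u a i
  defines "\<alpha> \<equiv> right_spec_partial u a i" and "\<beta> \<equiv> left_spec_partial u a i"
  defines "A \<equiv> sqrt (\<alpha>\<^sup>2 + 1)" and "B \<equiv> sqrt (\<beta>\<^sup>2 + 1)"
  shows "spec_partial u a i = (\<alpha> * B + \<beta> * A) / (A + B)"
proof -
  have AB: "A > 0" "B > 0" and sq: "A\<^sup>2 = \<alpha>\<^sup>2 + 1" "B\<^sup>2 = \<beta>\<^sup>2 + 1"
    by (simp_all add: A_def B_def add_nonneg_pos add_nonneg_nonneg)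
  show ?thesis
  proof (cases "\<alpha> + \<beta> = 0")
    case True
    then have "\<beta> = - \<alpha>" by simp
    moreover from this have "A = B" by (simp add: A_def B_def)
    ultimately show ?thesis
      by (simp add: spec_partial_def flip: \<alpha>_def \<beta>_def)
  next
    case False
    \<comment> \<open>Isolating the squares of \<open>A\<close> and \<open>B\<close> lets
      \<open>sq\<close> replace them; their constants then cancel the contribution of
      \<open>-1\<close>.\<close>
    have "(\<alpha> * \<beta> - 1 + A * B) * (A + B) = (\<alpha> * \<beta> - 1) * (A + B) + A\<^sup>2 * B + B\<^sup>2 * A"
      by (simp add: algebra_simps power2_eq_square)
    also have "\<dots> = (\<alpha> * B + \<beta> * A) * (\<alpha> + \<beta>)"
      unfolding sq by (simp add: algebra_simps power2_eq_square)
    finally have "(\<alpha> * \<beta> - 1 + A * B) / (\<alpha> + \<beta>) = (\<alpha> * B + \<beta> * A) / (A + B)"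
      using False AB by (simp add: frac_eq_eq)
    with False show ?thesis
      by (simp add: spec_partial_def Let_def real_sqrt_mult A_def B_def flip: \<alpha>_def \<beta>_def)
  qed
qed

text \<open>The chord in direction \<open>i\<close> lies in \<open>H\<close>, which gives one linear
  equation between two components of \<open>v\<close>. Solving without dividing by
  \<open>v $ 3\<close> also covers \<open>v $ 3 = 0\<close>, where the other component must
  vanish.\<close>

lemma normal_component:
  fixes v :: "real ^ 3"
  assumes "spec_partial_differentiable u a i" "perpendicular_to_plane v H" "photo_points u a \<subseteq> H"
  shows "v $ (if i = 1 then 1 else 2) = - v $ 3 * spec_partial u a i"
proof -
  let ?\<alpha> = "right_spec_partial u a i" and ?\<beta> = "left_spec_partial u a i" and ?m = "mid_lim u a i"
  define A B where AB_def: "A = sqrt (?\<alpha>\<^sup>2 + 1)" "B = sqrt (?\<beta>\<^sup>2 + 1)"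
  define x where "x = v $ (if i = 1 then 1 else 2)"
  have pos: "A > 0" "B > 0"
    by (simp_all add: AB_def add_nonneg_pos)
  have "phototangent u a i \<inter> sphere (graph_point a ?m) 1 \<subseteq> H"
    using assms(1,3) by (auto simp: photo_points_def)
  then have "v \<bullet> (graph_point (a + (1 / A) *\<^sub>R axis i 1) (?m + ?\<alpha> * (1 / A)) -
      graph_point (a + (- 1 / B) *\<^sub>R axis i 1) (?m + ?\<beta> * (- 1 / B))) = 0"
    using assms(2) phototangent_Int_sphere[OF assms(1)]
    by (auto simp: perpendicular_to_plane_def orthogonal_def AB_def)
  then have "(1 / A + 1 / B) * x + (?\<alpha> / A + ?\<beta> / B) * v $ 3 = 0"
    unfolding inner_graph_point_diff x_def by (simp add: field_simps split del: if_split)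
  then have "A * B * ((1 / A + 1 / B) * x + (?\<alpha> / A + ?\<beta> / B) * v $ 3) = 0"
    by simp
  then have "(A + B) * x = - v $ 3 * (?\<alpha> * B + ?\<beta> * A)"
    using pos by (simp add: algebra_simps)
  then have "x = (- v $ 3 * (?\<alpha> * B + ?\<beta> * A)) / (A + B)"
    using pos by (metis add_pos_pos less_irrefl nonzero_mult_div_cancel_left)
  then show ?thesis
    by (simp add: x_def spec_partial_alt AB_def)
qed

text \<open>If one direction fails, only the other can contribute, and it yields at most two of the
  required four points.\<close>

lemma spec_differentiable_imp_partial:
  assumes "spec_differentiable u a"
  shows "spec_partial_differentiable u a i"
proof (rule ccontr)
  assume i: "\<not> spec_partial_differentiable u a i"
  define j :: 2 where "j = (if i = 1 then 2 else 1)"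
  have "k = j" if "k \<noteq> i" for k
    using that exhaust_2[of k] exhaust_2[of i] by (auto simp: j_def)
  with i have sub: "{i. spec_partial_differentiable u a i} \<subseteq> {j}"
    by (metis mem_Collect_eq singletonI subsetI)
  have "\<exists>p q. photo_points u a \<subseteq> {p, q}"
  proof (cases "spec_partial_differentiable u a j")
    case True
    have "photo_points u a \<subseteq> phototangent u a j \<inter> sphere (graph_point a (mid_lim u a j)) 1"
      unfolding photo_points_def using sub by blast
    then show ?thesis
      unfolding phototangent_Int_sphere[OF True] by blast
  next
    case False
    with sub have "photo_points u a = {}"
      unfolding photo_points_def by blast
    then show ?thesis by simp
  qed
  then obtain p q where "photo_points u a \<subseteq> {p, q}" by blast
  then have "card (photo_points u a) \<le> card {p, q}"
    by (intro card_mono) auto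
  also have "\<dots> \<le> 2" by (simp add: card_insert_if)
  finally show False using assms by (simp add: spec_differentiable_def)
qed

theorem theorem3p17:
  fixes \<Omega> :: "(real ^ 2) set" and u :: "real ^ 2 \<Rightarrow> real" and a :: "real ^ 2"
  assumes "open \<Omega>" and "a \<in> \<Omega>"
    and "\<exists>H. strong_spec_tangent_hyperplane u a H"
  shows "\<forall>v. spec_normal_vector u a v \<longleftrightarrow>
           (\<exists>c. c \<noteq> 0 \<and> v = c *\<^sub>R vector [spec_partial u a 1, spec_partial u a 2, -1])"
proof -
  let ?n = "vector [spec_partial u a 1, spec_partial u a 2, -1] :: real ^ 3"
  obtain H where sd: "spec_differentiable u a" and H: "is_plane H" "photo_points u a \<subseteq> H"
    using assms(3) by (auto simp: strong_spec_tangent_hyperplane_def)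
  have card4: "card (photo_points u a) = 4" and mid: "mid_lim u a 1 = mid_lim u a 2"
    using sd by (auto simp: spec_differentiable_def)
  have mid': "mid_lim u a i = mid_lim u a j" for i j
    using exhaust_2[of i] exhaust_2[of j] mid by auto
  \<comment> \<open>The equal mean values make the two spheres one, as the uniqueness of the plane
    requires.\<close>
  have sphere: "photo_points u a \<subseteq> sphere (graph_point a (mid_lim u a 1)) 1"
  proof
    fix p
    assume "p \<in> photo_points u a"
    then obtain i where "p \<in> sphere (graph_point a (mid_lim u a i)) 1"
      by (auto simp: photo_points_def)
    then show "p \<in> sphere (graph_point a (mid_lim u a 1)) 1"
      by (simp only: mid'[of i 1])
  qed
  have weak_H: "weak_spec_tangent_hyperplane u a H"
    using H card4 mid'
    by (auto simp: weak_spec_tangent_hyperplane_def weakly_spec_differentiable_def Int_absorb1)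
  have weak_unique: "K = H" if "weak_spec_tangent_hyperplane u a K" for K
    using that H sphere
    by (intro plane_eq_if_three_sphere_points[where S = "K \<inter> photo_points u a"])
      (auto simp: weak_spec_tangent_hyperplane_def)
  have normal: "\<exists>c. c \<noteq> 0 \<and> v = c *\<^sub>R ?n" if "perpendicular_to_plane v H" for v
  proof -
    have "v $ 1 = - v $ 3 * spec_partial u a 1" "v $ 2 = - v $ 3 * spec_partial u a 2"
      using normal_component[OF spec_differentiable_imp_partial[OF sd] that H(2), of 1]
        normal_component[OF spec_differentiable_imp_partial[OF sd] that H(2), of 2] by simp_all
    \<comment> \<open>The last entry \<open>-1\<close> of \<open>?n\<close> forces the factor
      \<open>- v $ 3\<close>, which is nonzero because \<open>v\<close> is.\<close>
    then have "v = (- v $ 3) *\<^sub>R ?n"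
      by (simp add: vec_eq_iff forall_3)
    moreover have "v \<noteq> 0" using that by (simp add: perpendicular_to_plane_def)
    ultimately show ?thesis by (metis scaleR_zero_left)
  qed
  \<comment> \<open>\<open>normal\<close> only restricts the shape of a normal vector. Rescaling an
    actual normal \<open>w\<close> shows that \<open>?n\<close> itself is perpendicular to
    \<open>H\<close>, which the converse direction needs.\<close>
  obtain w where w: "perpendicular_to_plane w H"
    using plane_normal_exists[OF H(1)] ..
  then obtain d where "d \<noteq> 0" "w = d *\<^sub>R ?n"
    using normal by blast
  with w have n: "perpendicular_to_plane ?n H"
    using perpendicular_to_plane_scale[OF w, of "inverse d"] by simp
  show ?thesis
  proof (intro allI iffI)
    fix v
    assume "spec_normal_vector u a v"
    then show "\<exists>c. c \<noteq> 0 \<and> v = c *\<^sub>R ?n"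
      using weak_unique normal unfolding spec_normal_vector_def by blast
  next
    fix v
    assume "\<exists>c. c \<noteq> 0 \<and> v = c *\<^sub>R ?n"
    then show "spec_normal_vector u a v"
      using weak_H perpendicular_to_plane_scale[OF n] unfolding spec_normal_vector_def by blast
  qed
qed

end
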